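(* Let $(M,d)$ be a separable metric space and $1<\lambda\le 2$. If $M$ has property $\pi(\lambda)$, then there exists a map $f:M\to c_0$ which is both a strict-$\lambda$-embedding and a good-$\lambda$-embedding.
   Context: $c_0$ is the Banach space of real sequences converging to $0$ with the sup norm $\|\cdot\|$. For a map $g$ between metric spaces, $Lip(g)$ is its Lipschitz constant (the infimum of all admissible Lipschitz constants). A map $f:M\to c_0$ is a strict-$\lambda$-embedding if $d(x,y)<\|f(x)-f(y)\|<\lambda d(x,y)$ for all $x\ne y$ in $M$. A map $f=(f_n):M\to c_0$ is a good-$\lambda$-embedding if $Lip(f_n)<\lambda$ for each $n$ and for all $x,y\in M$ there is $n$ with $d(x,y)\le|f_n(x)-f_n(y)|$. For a nonempty $E\subset M\times M$, let $\pi_1(E)=\{x\in M:\exists y\in M,\ (x,y)\in E\}$, $\pi_2(E)=\{y\in M:\exists x\in M,\ (x,y)\in E\}$, $\pi(E)=\pi_1(E)\times\pi_2(E)$, $\delta(E)=\inf\{d(x,y):(x,y)\in E\}$ and $diam(E)=\sup\{d(x,y):(x,y)\in E\}$. $(M,d)$ has property $\pi(\lambda)$ if for all balls $B_1,B_2$ of $M$ of radii $r_1,r_2$ and every nonempty $E\subset B_1\times B_2$ with $\delta(E)>\lambda(r_1+r_2)$, there is a finite partition $\{E_1,\dots,E_N\}$ of $E$ such that $diam(E_n)<\lambda\,\delta(\pi(E_n))$ for each $n$. Here balls are closed balls of positive radius (using open balls gives an equivalent property). *)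

theory Defs
  imports "HOL-Analysis.Analysis" "HOL-Library.Disjoint_Sets"
begin

text \<open>
  Since \<open>nat\<close> is discrete, \<open>nat \<Rightarrow>\<^sub>C real\<close> is the Banach space of all bounded real sequences with the
  sup norm; \<open>c\<^sub>0\<close> is its subspace of null sequences (a null sequence is automatically bounded).
\<close>
definition c0 :: "(nat \<Rightarrow>\<^sub>C real) set"
  where "c0 = {u. (\<lambda>n. apply_bcontfun u n) \<longlonglongrightarrow> 0}"

text \<open>The infimum is taken in \<open>ereal\<close>, so that a map which is not Lipschitz has constant \<open>\<infinity>\<close>.\<close>
definition Lip :: "('a::metric_space \<Rightarrow> 'b::metric_space) \<Rightarrow> ereal"
  where "Lip g = Inf {ereal L |L. L-lipschitz_on UNIV g}"

definition strict_embedding :: "real \<Rightarrow> ('a::metric_space \<Rightarrow> (nat \<Rightarrow>\<^sub>C real)) \<Rightarrow> bool"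
  where "strict_embedding lam f \<longleftrightarrow>
    (\<forall>x y. x \<noteq> y \<longrightarrow> dist x y < norm (f x - f y) \<and> norm (f x - f y) < lam * dist x y)"

definition good_embedding :: "real \<Rightarrow> ('a::metric_space \<Rightarrow> (nat \<Rightarrow>\<^sub>C real)) \<Rightarrow> bool"
  where "good_embedding lam f \<longleftrightarrow>
    (\<forall>n. Lip (\<lambda>x. apply_bcontfun (f x) n) < ereal lam) \<and>
    (\<forall>x y. \<exists>n. dist x y \<le> \<bar>apply_bcontfun (f x) n - apply_bcontfun (f y) n\<bar>)"

definition pair_hull :: "('a \<times> 'a) set \<Rightarrow> ('a \<times> 'a) set"
  where "pair_hull E = {x. \<exists>y. (x, y) \<in> E} \<times> {y. \<exists>x. (x, y) \<in> E}"

text \<open>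
  For \<open>E \<noteq> {}\<close> the infimum is over a nonempty set that is bounded below by \<open>0\<close>; the supremum
  may be \<open>\<infinity>\<close> and is therefore taken in \<open>ereal\<close>.
\<close>
definition pair_delta :: "('a::metric_space \<times> 'a) set \<Rightarrow> real"
  where "pair_delta E = (INF (x, y)\<in>E. dist x y)"

definition pair_diam :: "('a::metric_space \<times> 'a) set \<Rightarrow> ereal"
  where "pair_diam E = (SUP (x, y)\<in>E. ereal (dist x y))"

text \<open>
  The space \<open>M\<close> is the whole type \<open>'a\<close>, which is supplied as an explicit type argument. A ball comes
  with its centre and its radius.
\<close>
definition property_pi :: "'a::metric_space itself \<Rightarrow> real \<Rightarrow> bool"
  where "property_pi _ lam \<longleftrightarrow>
    (\<forall>(a1::'a) a2 r1 r2 E.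
      0 < r1 \<longrightarrow> 0 < r2 \<longrightarrow> E \<noteq> {} \<longrightarrow> E \<subseteq> cball a1 r1 \<times> cball a2 r2 \<longrightarrow>
      pair_delta E > lam * (r1 + r2) \<longrightarrow>
      (\<exists>P. finite P \<and> partition_on E P \<and>
           (\<forall>F\<in>P. pair_diam F < ereal (lam * pair_delta (pair_hull F)))))"

end

theory Submission
  imports Defs
begin

text \<open>
  Write \<open>\<Delta>(F, e)\<close> for the set of pairs with \<open>dist x y > \<lambda> (dist(x, F) + dist(y, F)) + e\<close>. For finite \<open>F\<close>,
  property \<open>\<pi>(\<lambda>)\<close> splits \<open>\<Delta>(F, e)\<close> into finitely many sets \<open>E\<close> with \<open>diam(E) < \<lambda> \<delta>(\<pi>(E))\<close>. On
  such an \<open>E\<close>, a function with two bumps of opposite sign around the two projections of \<open>E\<close> has a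
  Lipschitz constant below \<open>\<lambda>\<close> and stretches every pair of \<open>E\<close>. If \<open>E\<close> avoids \<open>\<Delta>(G, e)\<close>, the
  heights of the bumps can be shared out so that the function is at most \<open>e\<close> on \<open>G\<close>. Apply this
  with \<open>G = F\<^sub>n\<close> and \<open>F = F\<^sub>n\<^sub>+\<^sub>1\<close>, where the finite sets \<open>F\<^sub>n\<close> increase to a dense set and \<open>F\<^sub>0\<close> is a
  singleton, and with tolerances \<open>e\<^sub>n\<close> tending to \<open>0\<close>. Since \<open>\<Delta>(F\<^sub>0, e\<^sub>0)\<close> is empty, every pair of
  distinct points lies in some \<open>\<Delta>(F\<^sub>n\<^sub>+\<^sub>1, e\<^sub>n\<^sub>+\<^sub>1) - \<Delta>(F\<^sub>n, e\<^sub>n)\<close> and is stretched at that stage. As the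
  functions are equi-Lipschitz and tend to \<open>0\<close> on a dense set, they tend to \<open>0\<close> everywhere.
\<close>

section \<open>Functions with two bumps of opposite sign\<close>

lemma le_infdist_add_infdist:
  fixes A B :: "'a::metric_space set"
  assumes "A \<noteq> {}" "B \<noteq> {}" and sep: "\<And>a b. a \<in> A \<Longrightarrow> b \<in> B \<Longrightarrow> \<delta> \<le> dist a b"
  shows "\<delta> \<le> infdist p A + dist p q + infdist q B"
proof -
  have "\<delta> - dist p q - infdist q B \<le> dist p a" if "a \<in> A" for a
  proof -
    have "\<delta> - dist p q - dist p a \<le> dist q b" if "b \<in> B" for b
      using sep[OF \<open>a \<in> A\<close> that] dist_triangle[of a b p] dist_triangle[of p b q]
      by (simp add: dist_commute)
    then have "\<delta> - dist p q - dist p a \<le> infdist q B"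
      unfolding infdist_notempty[OF assms(2)] by (intro cINF_greatest assms)
    then show ?thesis by simp
  qed
  then have "\<delta> - dist p q - infdist q B \<le> infdist p A"
    unfolding infdist_notempty[OF assms(1)] by (intro cINF_greatest assms)
  then show ?thesis by simp
qed

text \<open>Each bump alone is \<open>L\<close>-Lipschitz because \<open>infdist\<close> is
  1-Lipschitz. The critical case is \<open>p\<close> under the bump at \<open>B\<close> and
  \<open>q\<close> under the bump at \<open>A\<close>: the difference is then at most
  \<open>u + v - L * (infdist p B + infdist q A)\<close>, and
  \<open>u + v \<le> L * \<delta>\<close> reduces this to the triangle inequality.\<close>

lemma lipschitz_two_bumps:
  fixes A B :: "'a::metric_space set"
  assumes "A \<noteq> {}" "B \<noteq> {}" and sep: "\<And>a b. a \<in> A \<Longrightarrow> b \<in> B \<Longrightarrow> \<delta> \<le> dist a b"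
    and "0 \<le> L" and uv: "u + v \<le> L * \<delta>"
  shows "L-lipschitz_on UNIV (\<lambda>z. max 0 (v - L * infdist z B) - max 0 (u - L * infdist z A))"
    (is "_-lipschitz_on _ ?g")
proof (rule lipschitz_onI)
  have g: "?g p - ?g q \<le> L * dist p q" for p q
  proof -
    have "L * \<delta> \<le> L * (infdist q A + dist p q + infdist p B)"
      using le_infdist_add_infdist[OF assms(1-3), of q p] \<open>0 \<le> L\<close>
      by (intro mult_left_mono) (simp_all add: dist_commute)
    moreover have "L * infdist q B \<le> L * (infdist p B + dist p q)"
      using infdist_triangle[of q B p] \<open>0 \<le> L\<close>
      by (intro mult_left_mono) (simp_all add: dist_commute)
    moreover have "L * infdist p A \<le> L * (infdist q A + dist p q)"
      using infdist_triangle[of p A q] \<open>0 \<le> L\<close>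
      by (intro mult_left_mono) (simp_all add: dist_commute)
    moreover have "L * \<delta> \<le> L * (infdist p A + dist p p + infdist p B)"
      "L * \<delta> \<le> L * (infdist q A + dist q q + infdist q B)"
      using le_infdist_add_infdist[OF assms(1-3), of p p]
        le_infdist_add_infdist[OF assms(1-3), of q q] \<open>0 \<le> L\<close>
      by (intro mult_left_mono; simp)+
    moreover have "0 \<le> L * dist p q" using \<open>0 \<le> L\<close> by simp
    ultimately show ?thesis using uv by (simp add: algebra_simps max_def)
  qed
  show "dist (?g p) (?g q) \<le> L * dist p q" for p q
    using g[of p q] g[of q p] by (simp add: dist_real_def dist_commute abs_le_iff)
qed fact

text \<open>The heights \<open>u\<close> at \<open>A\<close> and \<open>v\<close> at
  \<open>B\<close> add up to slightly more than \<open>D\<close>. Points of \<open>G\<close> have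
  distance at least \<open>s\<close> from \<open>A\<close> and \<open>t\<close> from
  \<open>B\<close>, so heights up to \<open>L * s + e\<close> and \<open>L * t + e\<close> leave at
  most \<open>e\<close> on \<open>G\<close>; the hypothesis named \<open>D\<close> makes room for
  both.\<close>

lemma exists_bump_function:
  fixes A B :: "'a::metric_space set"
  assumes "A \<noteq> {}" "B \<noteq> {}" "G \<noteq> {}"
    and sep: "\<And>a b. a \<in> A \<Longrightarrow> b \<in> B \<Longrightarrow> \<delta> \<le> dist a b"
    and "0 < lam" "0 \<le> D" "D < lam * \<delta>" "0 < e" "0 \<le> s" "0 \<le> t"
    and D: "D < lam * (s + t) + 2 * e"
    and s: "\<And>a. a \<in> A \<Longrightarrow> s \<le> infdist a G" and t: "\<And>b. b \<in> B \<Longrightarrow> t \<le> infdist b G"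
  obtains g :: "'a \<Rightarrow> real" and L where "L < lam" "L-lipschitz_on UNIV g"
    "\<And>z. z \<in> G \<Longrightarrow> \<bar>g z\<bar> \<le> e" "\<And>a b. a \<in> A \<Longrightarrow> b \<in> B \<Longrightarrow> D < \<bar>g a - g b\<bar>"
proof -
  obtain D' where D': "D < D'" "D' < lam * \<delta>" "D' < lam * (s + t) + 2 * e"
    using dense[of D "min (lam * \<delta>) (lam * (s + t) + 2 * e)"] D \<open>D < lam * \<delta>\<close> by auto
  \<comment> \<open>The inequalities on \<open>D'\<close> are strict, so they persist for
    \<open>L\<close> slightly below \<open>lam\<close>.\<close>
  have "\<forall>\<^sub>F L in at_left lam. L < lam \<and> 0 < L \<and> D' < L * \<delta> \<and> D' < L * (s + t) + 2 * e"
    by (intro eventually_conj order_tendstoD(1)[of _ "lam * \<delta>"]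
        order_tendstoD(1)[of _ "lam * (s + t) + 2 * e"] order_tendstoD(1)[of _ lam]
        tendsto_intros D' \<open>0 < lam\<close> eventually_at_left_real)
      (auto simp: eventually_at_filter)
  then obtain L where L: "L < lam" "0 < L" "D' < L * \<delta>" "D' < L * (s + t) + 2 * e"
    using eventually_happens[of _ "at_left lam"] by auto
  \<comment> \<open>The height \<open>u\<close> is as large as its cap allows; the choice of
    \<open>L\<close> then keeps the remainder \<open>v\<close> below the cap
    \<open>L * t + e\<close>.\<close>
  define u where "u = min D' (L * s + e)"
  define v where "v = D' - u"
  define g where "g z = max 0 (v - L * infdist z B) - max 0 (u - L * infdist z A)" for z
  have uv: "0 \<le> u" "0 \<le> v" "u \<le> L * s + e" "v \<le> L * t + e" "u + v = D'"
    using L D' assms by (auto simp: u_def v_def min_def algebra_simps)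
  have lip: "L-lipschitz_on UNIV g"
    unfolding g_def using L uv by (intro lipschitz_two_bumps[OF assms(1,2) sep]) auto
  have far: "h \<le> infdist z S" if "z \<in> G" "S \<noteq> {}" "\<And>a. a \<in> S \<Longrightarrow> h \<le> infdist a G"
    for h z and S :: "'a set"
    unfolding infdist_notempty[OF that(2)]
    using that infdist_le[OF that(1)] by (intro cINF_greatest) (auto simp: dist_commute intro: order_trans)
  have small: "\<bar>g z\<bar> \<le> e" if "z \<in> G" for z
  proof -
    have "L * s \<le> L * infdist z A" "L * t \<le> L * infdist z B"
      using far[OF that \<open>A \<noteq> {}\<close> s] far[OF that \<open>B \<noteq> {}\<close> t] L by (auto intro: mult_left_mono)
    then show ?thesis using uv \<open>0 < e\<close> by (auto simp: g_def max_def abs_le_iff)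
  qed
  have sepg: "D < \<bar>g a - g b\<bar>" if "a \<in> A" "b \<in> B" for a b
  proof -
    have "L * \<delta> \<le> L * infdist a B" "L * \<delta> \<le> L * infdist b A"
      using le_infdist_add_infdist[OF assms(1,2) sep, of a a]
        le_infdist_add_infdist[OF assms(1,2) sep, of b b] that L
      by (auto intro!: mult_left_mono)
    then have "v \<le> L * infdist a B" "u \<le> L * infdist b A" using uv L by linarith+
    then have "g a = - u" "g b = v" using uv that by (auto simp: g_def max_def)
    then show ?thesis using uv D' by simp
  qed
  show ?thesis using that[OF L(1) lip small sepg] .
qed

section \<open>Splitting the pairs to be stretched into finitely many cells\<close>

text \<open>This is the set written \<Delta>(F, e) above. The excess \<open>e\<close> leaves room
  for rounding the distances to \<open>F\<close>.\<close>

definition stretched_pairs :: "real \<Rightarrow> 'a::metric_space set \<Rightarrow> real \<Rightarrow> ('a \<times> 'a) set"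
  where "stretched_pairs lam F e =
    {(x, y). lam * (infdist x F + infdist y F) + e < dist x y}"

lemma infdist_attained_finite:
  assumes "finite F" "F \<noteq> {}"
  obtains a where "a \<in> F" "infdist x F = dist x a"
proof -
  have "infdist x F = Min (dist x ` F)"
    using assms by (simp add: infdist_notempty cInf_eq_Min)
  then have "infdist x F \<in> dist x ` F" using assms by simp
  with that show ?thesis by auto
qed

text \<open>Going from \<open>x\<close> to \<open>y\<close> through nearest points of
  \<open>F\<close> gives \<open>dist x y \<le> infdist x F + diameter F + infdist y F\<close>; since
  \<open>lam > 1\<close>, this caps the two distances. Rounded, they then take only finitely many
  values.\<close>

lemma stretched_pairs_infdist_bound:
  assumes "finite F" "F \<noteq> {}" "1 < lam" "0 \<le> e"
  obtains C where "\<And>x y. (x, y) \<in> stretched_pairs lam F e \<Longrightarrow> infdist x F + infdist y F \<le> C"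
proof
  fix x y assume xy: "(x, y) \<in> stretched_pairs lam F e"
  obtain a b where a: "a \<in> F" "infdist x F = dist x a" and b: "b \<in> F" "infdist y F = dist y b"
    using infdist_attained_finite[OF assms(1,2)] by metis
  have "dist x y \<le> dist x a + dist a b + dist y b"
    using dist_triangle[of x y a] dist_triangle[of a y b] by (simp add: dist_commute)
  moreover have "dist a b \<le> diameter F"
    using a b assms by (intro diameter_bounded_bound finite_imp_bounded)
  ultimately have "(lam - 1) * (infdist x F + infdist y F) \<le> diameter F"
    using xy a b \<open>0 \<le> e\<close> by (simp add: stretched_pairs_def algebra_simps)
  then show "infdist x F + infdist y F \<le> diameter F / (lam - 1)"
    using \<open>1 < lam\<close> by (simp add: field_simps)
qed

lemma pair_delta_le:
  assumes "(x, y) \<in> E"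
  shows "pair_delta E \<le> dist x y"
proof -
  have "bdd_below ((\<lambda>(x, y). dist x y) ` E)" by (rule bdd_belowI[of _ 0]) auto
  from cINF_lower[OF this assms] show ?thesis by (simp add: pair_delta_def)
qed

lemma le_pair_delta:
  assumes "E \<noteq> {}" "\<And>x y. (x, y) \<in> E \<Longrightarrow> c \<le> dist x y"
  shows "c \<le> pair_delta E"
  unfolding pair_delta_def using assms by (intro cINF_greatest) auto

lemma finite_image_floor:
  fixes h :: "'b \<Rightarrow> real"
  assumes "\<And>p. p \<in> S \<Longrightarrow> 0 \<le> h p" "\<And>p. p \<in> S \<Longrightarrow> h p \<le> C" "0 < \<eta>"
  shows "finite ((\<lambda>p. \<lfloor>h p / \<eta>\<rfloor>) ` S)"
proof (rule finite_subset)
  show "(\<lambda>p. \<lfloor>h p / \<eta>\<rfloor>) ` S \<subseteq> {0..\<lfloor>C / \<eta>\<rfloor>}"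
    using assms by (auto intro!: floor_mono divide_right_mono)
qed simp

definition gentle :: "real \<Rightarrow> 'a::metric_space set \<Rightarrow> real \<Rightarrow> ('a \<Rightarrow> real) \<Rightarrow> bool"
  where "gentle lam G e g \<longleftrightarrow>
    (\<exists>L<lam. L-lipschitz_on UNIV g) \<and> (\<forall>z\<in>G. \<bar>g z\<bar> \<le> e)"

definition separates :: "('a::metric_space \<Rightarrow> real) set \<Rightarrow> ('a \<times> 'a) set \<Rightarrow> bool"
  where "separates \<Phi> X \<longleftrightarrow> (\<forall>(x, y)\<in>X. \<exists>g\<in>\<Phi>. dist x y < \<bar>g x - g y\<bar>)"

lemma separatesD:
  assumes "separates \<Phi> X" "(x, y) \<in> X"
  obtains g where "g \<in> \<Phi>" "dist x y < \<bar>g x - g y\<bar>"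
  using assms unfolding separates_def by blast

text \<open>Property \<pi> cuts \<open>E\<close> into finitely many pieces \<open>Q\<close>, and
  each piece gets one bump function, built on its two projections with \<open>D\<close> the diameter
  of \<open>Q\<close>.\<close>

lemma gentle_separates_cell:
  fixes E :: "('a::metric_space \<times> 'a) set"
  assumes pi: "property_pi TYPE('a) lam" and "0 < lam" "E \<noteq> {}"
    and E: "E \<subseteq> cball a r1 \<times> cball b r2" "0 < r1" "0 < r2" "lam * (r1 + r2) < pair_delta E"
    and "G \<noteq> {}" "0 < e" "0 \<le> s" "0 \<le> t"
    and st: "\<And>x y. (x, y) \<in> E \<Longrightarrow> s \<le> infdist x G \<and> t \<le> infdist y G"
    and le: "\<And>x y. (x, y) \<in> E \<Longrightarrow> dist x y \<le> lam * (s + t) + 3 / 2 * e"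
  shows "\<exists>\<Phi>. finite \<Phi> \<and> (\<forall>g\<in>\<Phi>. gentle lam G e g) \<and> separates \<Phi> E"
proof -
  obtain P where P: "finite P" "partition_on E P"
    "\<And>Q. Q \<in> P \<Longrightarrow> pair_diam Q < ereal (lam * pair_delta (pair_hull Q))"
    using pi E \<open>E \<noteq> {}\<close> unfolding property_pi_def by metis
  have "\<exists>g. gentle lam G e g \<and> (\<forall>(x, y)\<in>Q. dist x y < \<bar>g x - g y\<bar>)" if "Q \<in> P" for Q
  proof -
    have Q: "Q \<noteq> {}" "Q \<subseteq> E"
      using P(2) that by (auto dest: partition_onD1 partition_onD3)
    have up: "ereal (dist x y) \<le> pair_diam Q" if "(x, y) \<in> Q" for x y
      unfolding pair_diam_def using that by (intro SUP_upper2[of "(x, y)"]) auto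
    obtain x0 y0 where xy0: "(x0, y0) \<in> Q" using Q by auto
    obtain D where D: "pair_diam Q = ereal D"
      using up[OF xy0] P(3)[OF \<open>Q \<in> P\<close>] by (cases "pair_diam Q") auto
    have "pair_diam Q \<le> ereal (lam * (s + t) + 3 / 2 * e)"
      unfolding pair_diam_def using le Q by (intro SUP_least) auto
    \<comment> \<open>The supremum satisfies only a weak bound; enlarging \<open>3 / 2 * e\<close>
      to \<open>2 * e\<close> makes it strict.\<close>
    then have "D < lam * (s + t) + 2 * e" using D \<open>0 < e\<close> by simp
    moreover have "0 \<le> D" using order_trans[OF zero_le_dist[of x0 y0], of D] up[OF xy0] unfolding D by simp
    moreover have "D < lam * pair_delta (pair_hull Q)" using P(3)[OF that] D by simp
    moreover have "pair_delta (pair_hull Q) \<le> dist x y" if "x \<in> fst ` Q" "y \<in> snd ` Q" for x y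
      using that by (intro pair_delta_le) (force simp: pair_hull_def)
    moreover have "s \<le> infdist x G" if "x \<in> fst ` Q" for x
      using that st Q(2) by force
    moreover have "t \<le> infdist y G" if "y \<in> snd ` Q" for y
      using that st Q(2) by force
    moreover have "fst ` Q \<noteq> {}" "snd ` Q \<noteq> {}" using Q(1) by simp_all
    ultimately obtain g L where g: "L < lam" "L-lipschitz_on UNIV g"
      "\<And>z. z \<in> G \<Longrightarrow> \<bar>g z\<bar> \<le> e" "\<And>x y. x \<in> fst ` Q \<Longrightarrow> y \<in> snd ` Q \<Longrightarrow> D < \<bar>g x - g y\<bar>"
      using exists_bump_function[of "fst ` Q" "snd ` Q" G "pair_delta (pair_hull Q)" lam D e s t]
        \<open>0 < lam\<close> \<open>G \<noteq> {}\<close> \<open>0 < e\<close> \<open>0 \<le> s\<close> \<open>0 \<le> t\<close> by metis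
    have "dist x y < \<bar>g x - g y\<bar>" if "(x, y) \<in> Q" for x y
    proof -
      have "dist x y \<le> D" using up[OF that] D by simp
      also have "D < \<bar>g x - g y\<bar>" using that by (intro g(4)) (force intro: rev_image_eqI)+
      finally show ?thesis .
    qed
    then show ?thesis using g unfolding gentle_def by blast
  qed
  then obtain g where g: "\<And>Q. Q \<in> P \<Longrightarrow> gentle lam G e (g Q)"
    "\<And>Q x y. Q \<in> P \<Longrightarrow> (x, y) \<in> Q \<Longrightarrow> dist x y < \<bar>g Q x - g Q y\<bar>"
    by (metis (no_types, lifting) case_prodD)
  have "\<exists>g'\<in>g ` P. dist x y < \<bar>g' x - g' y\<bar>" if "(x, y) \<in> E" for x y
    using that P(2) g(2) unfolding partition_on_def by blast
  then show ?thesis using P(1) g(1) by (intro exI[of _ "g ` P"]) (auto simp: separates_def)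
qed

text \<open>The cells are the fibres of \<open>\<kappa>\<close>, which records nearest points in
  \<open>F\<close> and the rounded distances to \<open>F\<close> and \<open>G\<close>. Membership in
  \<Delta>(F, e') places a cell in a product of two balls to which property \<pi> applies; avoiding
  \<Delta>(G, e) bounds its distances as the bumps require.\<close>

lemma gentle_separates_stretched_pairs:
  fixes F G :: "'a::metric_space set"
  assumes pi: "property_pi TYPE('a) lam" and lam: "1 < lam"
    and F: "finite F" "F \<noteq> {}" and G: "G \<noteq> {}" and e: "0 < e" "0 < e'"
  shows "\<exists>\<Phi>. finite \<Phi> \<and> (\<forall>g\<in>\<Phi>. gentle lam G e g) \<and>
    separates \<Phi> (stretched_pairs lam F e' - stretched_pairs lam G e)"
proof -
  define S where "S = stretched_pairs lam F e' - stretched_pairs lam G e"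
  \<comment> \<open>Rounding two distances with mesh \<open>\<eta>\<close> changes
    \<open>lam\<close> times their sum by at most \<open>2 * lam * \<eta>\<close>, hence by at most
    half of \<open>e\<close> and of \<open>e'\<close>.\<close>
  define \<eta> where "\<eta> = min e e' / (4 * lam)"
  have \<eta>: "0 < \<eta>" "4 * (lam * \<eta>) \<le> e" "4 * (lam * \<eta>) \<le> e'"
    using lam e by (auto simp: \<eta>_def)
  have "\<exists>a. a \<in> F \<and> infdist x F = dist x a" for x
    using infdist_attained_finite[OF F] by blast
  then obtain a where a: "\<And>x. a x \<in> F" "\<And>x. infdist x F = dist x (a x)"
    by metis
  define i where "i H x = \<lfloor>infdist x H / \<eta>\<rfloor>" for H and x :: 'a
  have i: "\<eta> * i H x \<le> infdist x H" "infdist x H < \<eta> * i H x + \<eta>" "0 \<le> \<eta> * i H x" for H x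
  proof -
    have "i H x \<le> infdist x H / \<eta>" "infdist x H / \<eta> < i H x + 1" "0 \<le> i H x"
      using \<open>0 < \<eta>\<close> by (simp_all add: i_def infdist_nonneg)
    then show "\<eta> * i H x \<le> infdist x H" "infdist x H < \<eta> * i H x + \<eta>" "0 \<le> \<eta> * i H x"
      using \<open>0 < \<eta>\<close> by (simp_all add: field_simps)
  qed
  obtain C where C: "\<And>x y. (x, y) \<in> S \<Longrightarrow> infdist x F + infdist y F \<le> C"
    using stretched_pairs_infdist_bound[OF F lam, of e'] e unfolding S_def by (metis DiffD1 less_imp_le)
  \<comment> \<open>Every point of \<open>F\<close> is within \<open>K\<close> of \<open>G\<close>,
    so the bound on distances to \<open>F\<close> carries over to \<open>G\<close>.\<close>
  define K where "K = Max ((\<lambda>z. infdist z G) ` F)"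
  have K: "infdist z G \<le> infdist z F + K" for z
  proof -
    have "infdist (a z) G \<le> K" using F a by (auto simp: K_def)
    then show ?thesis using infdist_triangle[of z G "a z"] a(2)[of z] by simp
  qed
  have K0: "0 \<le> K" using F infdist_nonneg[of _ G] by (auto simp: K_def Max_ge_iff)
  define \<kappa> where "\<kappa> = (\<lambda>(x, y). (a x, a y, i F x, i F y, i G x, i G y))"
  have fin: "finite ((\<lambda>p. i H (fst p)) ` S)" "finite ((\<lambda>p. i H (snd p)) ` S)" if "H = F \<or> H = G" for H
    unfolding i_def
  proof -
    have "infdist (fst p) H \<le> C + K \<and> infdist (snd p) H \<le> C + K" if "p \<in> S" for p
      using C[of "fst p" "snd p"] K[of "fst p"] K[of "snd p"] that \<open>H = F \<or> H = G\<close> K0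
        infdist_nonneg[of "fst p" F] infdist_nonneg[of "snd p" F] by auto
    then show "finite ((\<lambda>p. \<lfloor>infdist (fst p) H / \<eta>\<rfloor>) ` S)" "finite ((\<lambda>p. \<lfloor>infdist (snd p) H / \<eta>\<rfloor>) ` S)"
      using \<open>0 < \<eta>\<close> by (auto intro!: finite_image_floor infdist_nonneg)
  qed
  have "\<kappa> ` S \<subseteq> F \<times> F \<times> (\<lambda>p. i F (fst p)) ` S \<times> (\<lambda>p. i F (snd p)) ` S \<times>
      (\<lambda>p. i G (fst p)) ` S \<times> (\<lambda>p. i G (snd p)) ` S"
    using a by (force simp: \<kappa>_def)
  then have fin\<kappa>: "finite (\<kappa> ` S)"
    by (rule finite_subset) (intro finite_cartesian_product F fin; simp)
  have "\<exists>\<Phi>. finite \<Phi> \<and> (\<forall>g\<in>\<Phi>. gentle lam G e g) \<and>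
    separates \<Phi> {q \<in> S. \<kappa> q = c}" if "c \<in> \<kappa> ` S" for c
  proof -
    obtain x0 y0 where p: "(x0, y0) \<in> S" "\<kappa> (x0, y0) = c" using \<open>c \<in> \<kappa> ` S\<close> by auto
    define E where "E = {q \<in> S. \<kappa> q = c}"
    have E: "(x, y) \<in> S" "a x = a x0" "a y = a y0" "i F x = i F x0" "i F y = i F y0"
      "i G x = i G x0" "i G y = i G y0" if "(x, y) \<in> E" for x y
      using that p by (auto simp: E_def \<kappa>_def)
    \<comment> \<open>The radii are rounded up: they serve the whole cell, and the added
      \<open>\<eta>\<close> keeps them positive.\<close>
    define r1 r2 where "r1 = \<eta> * i F x0 + \<eta>" and "r2 = \<eta> * i F y0 + \<eta>"
    have "dist (a x0) x \<le> r1 \<and> dist (a y0) y \<le> r2" if "(x, y) \<in> E" for x y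
      using i(2)[of x F] i(2)[of y F] E[OF that] a(2)[of x] a(2)[of y]
      by (simp add: r1_def r2_def dist_commute)
    then have ball: "E \<subseteq> cball (a x0) r1 \<times> cball (a y0) r2" by auto
    have ne: "E \<noteq> {}" using p by (auto simp: E_def)
    \<comment> \<open>The margin \<open>e' / 2\<close> survives the infimum over \<open>E\<close>
      and gives the strict inequality of property \<pi>.\<close>
    have "lam * (r1 + r2) + e' / 2 \<le> dist x y" if "(x, y) \<in> E" for x y
    proof -
      have "lam * (r1 + r2 - 2 * \<eta>) \<le> lam * (infdist x F + infdist y F)"
        using i(1)[of F x] i(1)[of F y] E[OF that] lam
        by (intro mult_left_mono) (simp_all add: r1_def r2_def)
      also have "\<dots> < dist x y - e'"
        using E(1)[OF that] by (simp add: S_def stretched_pairs_def)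
      finally show ?thesis using \<eta> by (simp add: algebra_simps)
    qed
    from le_pair_delta[OF ne this] have del: "lam * (r1 + r2) < pair_delta E" using e by simp
    show ?thesis unfolding E_def[symmetric]
    \<comment> \<open>The rounded-down distances to \<open>G\<close> serve as \<open>s\<close> and
      \<open>t\<close>.\<close>
    proof (rule gentle_separates_cell[OF pi _ ne ball _ _ del G \<open>0 < e\<close> i(3) i(3)])
      show "0 < lam" "0 < r1" "0 < r2"
        using lam i(3)[of F x0] i(3)[of F y0] \<open>0 < \<eta>\<close> by (auto simp: r1_def r2_def)
      show "\<eta> * i G x0 \<le> infdist x G \<and> \<eta> * i G y0 \<le> infdist y G" if "(x, y) \<in> E" for x y
        using i(1)[of G x] i(1)[of G y] E[OF that] by simp
      show "dist x y \<le> lam * (\<eta> * i G x0 + \<eta> * i G y0) + 3 / 2 * e" if "(x, y) \<in> E" for x y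
      proof -
        have "dist x y \<le> lam * (infdist x G + infdist y G) + e"
          using E(1)[OF that] by (simp add: S_def stretched_pairs_def)
        also have "lam * (infdist x G + infdist y G) \<le> lam * (\<eta> * i G x0 + \<eta> * i G y0 + 2 * \<eta>)"
          using i(2)[of x G] i(2)[of y G] E[OF that] lam by (intro mult_left_mono) simp_all
        finally show ?thesis using \<eta> by (simp add: algebra_simps)
      qed
    qed
  qed
  then have "\<forall>c\<in>\<kappa> ` S. \<exists>\<Phi>. finite \<Phi> \<and> (\<forall>g\<in>\<Phi>. gentle lam G e g) \<and>
    separates \<Phi> {q \<in> S. \<kappa> q = c}" by blast
  from bchoice[OF this] obtain \<Phi> where \<Phi>: "\<And>c. c \<in> \<kappa> ` S \<Longrightarrow> finite (\<Phi> c)"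
    "\<And>c. c \<in> \<kappa> ` S \<Longrightarrow> \<forall>g\<in>\<Phi> c. gentle lam G e g"
    "\<And>c. c \<in> \<kappa> ` S \<Longrightarrow> separates (\<Phi> c) {q \<in> S. \<kappa> q = c}"
    by blast
  define \<Psi> where "\<Psi> = (\<Union>c\<in>\<kappa> ` S. \<Phi> c)"
  have "finite \<Psi>" unfolding \<Psi>_def using fin\<kappa> \<Phi>(1) by (rule finite_UN_I)
  moreover have "\<forall>g\<in>\<Psi>. gentle lam G e g" unfolding \<Psi>_def using \<Phi>(2) by blast
  moreover have "separates \<Psi> S"
    unfolding separates_def
  proof clarify
    fix x y assume xy: "(x, y) \<in> S"
    obtain g where "g \<in> \<Phi> (\<kappa> (x, y))" "dist x y < \<bar>g x - g y\<bar>"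
      by (rule separatesD[OF \<Phi>(3)[OF imageI[OF xy]]]) (use xy in simp)
    then show "\<exists>g\<in>\<Psi>. dist x y < \<bar>g x - g y\<bar>" using xy unfolding \<Psi>_def by blast
  qed
  ultimately show ?thesis unfolding S_def by blast
qed

section \<open>Assembling all stages into one null sequence of functions\<close>

lemma lipschitz_null_on_dense:
  fixes h :: "nat \<Rightarrow> 'a::metric_space \<Rightarrow> real"
  assumes lip: "\<And>k. L-lipschitz_on UNIV (h k)" and dense: "closure C = UNIV"
    and null: "\<And>z. z \<in> C \<Longrightarrow> (\<lambda>k. h k z) \<longlonglongrightarrow> 0"
  shows "(\<lambda>k. h k x) \<longlonglongrightarrow> 0"
proof (rule tendstoI)
  fix r :: real assume "0 < r"
  have "0 \<le> L" using lip[of 0] by (rule lipschitz_on_nonneg)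
  \<comment> \<open>The factor \<open>L + 1\<close> avoids a division by zero when
    \<open>L = 0\<close>.\<close>
  obtain z where z: "z \<in> C" "dist z x < r / (2 * (L + 1))"
    using dense closure_approachable[of x C] \<open>0 < r\<close> \<open>0 \<le> L\<close>
    by (metis UNIV_I add_nonneg_pos divide_pos_pos mult_pos_pos zero_less_numeral zero_less_one)
  have "dist (h k x) (h k z) < r / 2" for k
  proof -
    have "dist (h k x) (h k z) \<le> (L + 1) * dist z x"
      using lipschitz_onD[OF lip, of x z k] by (simp add: dist_commute algebra_simps add_increasing)
    also have "\<dots> < r / 2" using z(2) \<open>0 \<le> L\<close> by (simp add: field_simps)
    finally show ?thesis .
  qed
  then have *: "dist (h k x) 0 < r / 2 + dist (h k z) 0" for k
    using dist_triangle[of "h k x" 0 "h k z"] by (smt (verit))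
  have "\<forall>\<^sub>F k in sequentially. dist (h k z) 0 < r / 2"
    using null[OF z(1)] \<open>0 < r\<close> by (intro tendstoD) auto
  then show "\<forall>\<^sub>F k in sequentially. dist (h k x) 0 < r"
    by eventually_elim (use * in \<open>smt (verit) field_sum_of_halves\<close>)
qed

lemma exists_null_separating_sequence:
  fixes lam :: real
  assumes "separable_space (euclidean :: 'a::metric_space topology)"
    and lam: "1 < lam" and pi: "property_pi TYPE('a::metric_space) lam"
  obtains h :: "nat \<Rightarrow> 'a::metric_space \<Rightarrow> real" where "\<And>k. \<exists>L<lam. L-lipschitz_on UNIV (h k)"
    "\<And>x. (\<lambda>k. h k x) \<longlonglongrightarrow> 0" "\<And>x y. x \<noteq> y \<Longrightarrow> \<exists>k. dist x y < \<bar>h k x - h k y\<bar>"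
proof -
  obtain C :: "'a set" where C: "countable C" "closure C = UNIV"
    using assms(1) by (auto simp: separable_space_def)
  then have "C \<noteq> {}" by auto
  define z where "z = from_nat_into C"
  have z: "range z = C" using C \<open>C \<noteq> {}\<close> by (simp add: z_def range_from_nat_into)
  define F where "F n = z ` {..n}" for n
  define e where "e = (\<lambda>n. 1 / real (Suc n))"
  have e: "0 < e n" "e \<longlonglongrightarrow> 0" for n
    using LIMSEQ_inverse_real_of_nat by (simp_all add: e_def inverse_eq_divide)
  have "\<exists>\<Phi>. finite \<Phi> \<and> (\<forall>g\<in>\<Phi>. gentle lam (F n) (e n) g) \<and>
      separates \<Phi> (stretched_pairs lam (F (Suc n)) (e (Suc n)) - stretched_pairs lam (F n) (e n))"
    (is "\<exists>\<Phi>. ?Q n \<Phi>") for n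
    using lam e by (intro gentle_separates_stretched_pairs pi) (auto simp: F_def)
  then have "\<forall>n. \<exists>\<Phi>. ?Q n \<Phi>" by blast
  from choice[OF this] obtain \<Phi> where \<Phi>: "\<And>n. finite (\<Phi> n)"
    "\<And>n. \<forall>g\<in>\<Phi> n. gentle lam (F n) (e n) g"
    "\<And>n. separates (\<Phi> n)
      (stretched_pairs lam (F (Suc n)) (e (Suc n)) - stretched_pairs lam (F n) (e n))"
    by blast
  \<comment> \<open>The zero functions make \<open>S\<close> infinite, so that it has an enumeration without repetitions;
    a repeated function would destroy the convergence to \<open>0\<close>.\<close>
  define S where "S = (SIGMA n:UNIV. insert (\<lambda>_. 0) (\<Phi> n))"
  have gentle: "gentle lam (F n) (e n) g" if "(n, g) \<in> S" for n g
  proof -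
    have "0-lipschitz_on UNIV (\<lambda>_::'a. 0::real)" by (rule lipschitz_on_constant)
    then have "gentle lam (F n) (e n) (\<lambda>_. 0)"
      using lam e(1)[of n] unfolding gentle_def by (intro conjI exI[of _ 0]) auto
    then show ?thesis using that \<Phi>(2) by (auto simp: S_def)
  qed
  have "countable S"
    unfolding S_def using \<Phi>(1) by (intro countable_SIGMA countable_insert) (auto intro: countable_finite)
  moreover have "infinite S"
  proof
    assume "finite S"
    then have "finite (fst ` S)" by simp
    moreover have "fst ` S = UNIV" by (force simp: S_def)
    ultimately show False by simp
  qed
  ultimately have bij: "bij_betw (from_nat_into S) UNIV S" by (rule bij_betw_from_nat_into)
  define h where "h k = snd (from_nat_into S k)" for k
  have inS: "(fst (from_nat_into S k), h k) \<in> S" for k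
    using bij by (auto simp: h_def bij_betw_def)
  have h: "\<exists>L<lam. L-lipschitz_on UNIV (h k)" for k
    using gentle[OF inS] by (auto simp: gentle_def)
  have null: "(\<lambda>k. h k x) \<longlonglongrightarrow> 0" for x
  proof (rule lipschitz_null_on_dense[OF _ C(2)])
    show "lam-lipschitz_on UNIV (h k)" for k
      using h[of k] by (meson less_imp_le lipschitz_on_le)
    show "(\<lambda>k. h k w) \<longlonglongrightarrow> 0" if "w \<in> C" for w
    proof (rule tendstoI)
      fix r :: real assume "0 < r"
      obtain m where m: "w = z m" using z \<open>w \<in> C\<close> by blast
      obtain N where N: "\<And>n. N \<le> n \<Longrightarrow> e n < r"
        using order_tendstoD(2)[OF e(2) \<open>0 < r\<close>] by (auto simp: eventually_sequentially)
      \<comment> \<open>From stage \<open>max m N\<close> on, \<open>w\<close> lies in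
        \<open>F n\<close> and \<open>e n < r\<close>. A failing index thus comes from one of
        finitely many pairs, each enumerated once.\<close>
      have "{k. \<not> dist (h k w) 0 < r} \<subseteq>
          from_nat_into S -` (SIGMA n:{..<max m N}. insert (\<lambda>_. 0) (\<Phi> n))"
      proof
        fix k assume k: "k \<in> {k. \<not> dist (h k w) 0 < r}"
        let ?n = "fst (from_nat_into S k)"
        have "?n < max m N"
        proof (rule ccontr)
          assume "\<not> ?n < max m N"
          then have "\<bar>h k w\<bar> \<le> e ?n" "e ?n < r"
            using gentle[OF inS[of k]] N by (auto simp: gentle_def F_def m)
          with k show False by simp
        qed
        then have "(?n, h k) \<in> (SIGMA n:{..<max m N}. insert (\<lambda>_. 0) (\<Phi> n))"
          using inS[of k] by (auto simp: S_def)
        then show "k \<in> from_nat_into S -` (SIGMA n:{..<max m N}. insert (\<lambda>_. 0) (\<Phi> n))"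
          by (simp add: h_def)
      qed
      moreover have "finite (from_nat_into S -` (SIGMA n:{..<max m N}. insert (\<lambda>_. 0) (\<Phi> n)))"
        using \<Phi>(1) bij by (intro finite_vimageI) (auto simp: bij_betw_def)
      ultimately have "finite {k. \<not> dist (h k w) 0 < r}" by (rule finite_subset)
      then show "\<forall>\<^sub>F k in sequentially. dist (h k w) 0 < r"
        by (simp flip: cofinite_eq_sequentially add: eventually_cofinite)
    qed
  qed
  have "\<exists>k. dist x y < \<bar>h k x - h k y\<bar>" if "x \<noteq> y" for x y
  proof -
    let ?P = "\<lambda>n. (x, y) \<in> stretched_pairs lam (F n) (e n)"
    \<comment> \<open>With this \<open>c\<close>, the term \<open>lam * (c + c)\<close> uses half of
      \<open>dist x y\<close> and leaves the other half for \<open>e n\<close>.\<close>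
    define c where "c = dist x y / (4 * lam)"
    have c: "0 < c" using that lam by (simp add: c_def)
    have near: "\<exists>m. \<forall>n\<ge>m. infdist w (F n) \<le> c" for w
    proof -
      obtain m where "dist (z m) w < c"
        using closure_approachable[of w C] C(2) z c by (metis UNIV_I rangeE)
      then show ?thesis by (intro exI[of _ m]) (auto simp: F_def dist_commute intro!: infdist_le2[of "z m"])
    qed
    obtain m1 m2 where m: "\<And>n. m1 \<le> n \<Longrightarrow> infdist x (F n) \<le> c" "\<And>n. m2 \<le> n \<Longrightarrow> infdist y (F n) \<le> c"
      using near[of x] near[of y] by auto
    obtain m3 where m3: "\<And>n. m3 \<le> n \<Longrightarrow> e n < dist x y / 2"
      using order_tendstoD(2)[OF e(2), of "dist x y / 2"] \<open>x \<noteq> y\<close>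
      by (auto simp: eventually_sequentially)
    define n where "n = max m1 (max m2 m3)"
    have "lam * (infdist x (F n) + infdist y (F n)) \<le> lam * (c + c)"
      using m[of n] lam by (intro mult_left_mono add_mono) (auto simp: n_def)
    moreover have "lam * (c + c) = dist x y / 2" using lam by (simp add: c_def)
    moreover have "e n < dist x y / 2" by (intro m3) (simp add: n_def)
    ultimately have "?P n" by (simp add: stretched_pairs_def)
    \<comment> \<open>Here \<open>F 0\<close> is the single point \<open>z 0\<close>, so the
      triangle inequality and \<open>lam > 1\<close> suffice.\<close>
    moreover have "\<not> ?P 0"
    proof -
      have "dist x y \<le> dist x (z 0) + dist y (z 0)" by (rule dist_triangle2)
      also have "\<dots> \<le> lam * (dist x (z 0) + dist y (z 0))"
        using lam mult_right_mono[of 1 lam "dist x (z 0) + dist y (z 0)"] by simp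
      finally show ?thesis using e(1)[of 0] by (simp add: stretched_pairs_def F_def)
    qed
    \<comment> \<open>At the index where membership switches from false to true, the pair lies in
      the difference handled by \<open>\<Phi> j\<close>.\<close>
    ultimately obtain j where "\<not> ?P j" "?P (Suc j)"
      using nat_induct[of "\<lambda>n. \<not> ?P n" n] by blast
    then obtain g where g: "g \<in> \<Phi> j" "dist x y < \<bar>g x - g y\<bar>"
      using separatesD[OF \<Phi>(3)[of j], of x y] by blast
    then have "(j, g) \<in> S" by (simp add: S_def)
    then obtain k where "from_nat_into S k = (j, g)" using bij by (metis bij_betw_def rangeE)
    then show ?thesis using g(2) by (intro exI[of _ k]) (simp add: h_def)
  qed
  with h null show ?thesis by (rule that)
qed

section \<open>The norm on \<open>c0\<close> and the embedding\<close>

lemma null_sequence_in_bcontfun: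
  fixes u :: "nat \<Rightarrow> real"
  assumes "u \<longlonglongrightarrow> 0"
  shows "u \<in> bcontfun"
  using convergent_imp_bounded[OF assms] by (simp add: bcontfun_def)

text \<open>All but finitely many entries of a null sequence lie below a given non-zero one, so the
  supremum is a maximum. This matters because a supremum of numbers below
  \<open>lam * dist x y\<close> could still equal it.\<close>

lemma c0_norm_attained:
  assumes "u \<in> c0"
  obtains n where "norm u = \<bar>apply_bcontfun u n\<bar>"
proof -
  have lim: "(\<lambda>n. \<bar>apply_bcontfun u n\<bar>) \<longlonglongrightarrow> 0"
    using assms tendsto_rabs_zero by (auto simp: c0_def)
  obtain n where n: "\<And>k. \<bar>apply_bcontfun u k\<bar> \<le> \<bar>apply_bcontfun u n\<bar>"
  proof (cases "\<forall>k. apply_bcontfun u k = 0")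
    case False
    then obtain j where j: "0 < \<bar>apply_bcontfun u j\<bar>" by auto
    obtain N where N: "\<And>k. N \<le> k \<Longrightarrow> \<bar>apply_bcontfun u k\<bar> < \<bar>apply_bcontfun u j\<bar>"
      using order_tendstoD(2)[OF lim j] by (auto simp: eventually_sequentially)
    \<comment> \<open>The range contains \<open>j\<close>, so the maximum also dominates the entries
      beyond \<open>N\<close>.\<close>
    define T where "T = (\<lambda>k. \<bar>apply_bcontfun u k\<bar>) ` {..max j N}"
    have T: "finite T" "\<bar>apply_bcontfun u k\<bar> \<in> T" if "k \<le> max j N" for k
      using that by (auto simp: T_def)
    have "Max T \<in> T" by (intro Max_in) (auto simp: T_def)
    then obtain n where "Max T = \<bar>apply_bcontfun u n\<bar>" unfolding T_def by blast
    moreover have "\<bar>apply_bcontfun u k\<bar> \<le> Max T" for k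
    proof (cases "k \<le> max j N")
      case True
      then show ?thesis using T by (intro Max_ge) auto
    next
      case False
      then have "\<bar>apply_bcontfun u k\<bar> \<le> \<bar>apply_bcontfun u j\<bar>" by (intro less_imp_le N) simp
      also have "\<dots> \<le> Max T" using T[of j] by (intro Max_ge) auto
      finally show ?thesis .
    qed
    ultimately show ?thesis using that by metis
  qed (use that in simp)
  have "norm u \<le> \<bar>apply_bcontfun u n\<bar>" using n by (intro norm_bound) simp
  moreover have "\<bar>apply_bcontfun u n\<bar> \<le> norm u" using norm_bounded[of u n] by simp
  ultimately show ?thesis using that by (metis antisym)
qed

theorem theorem4p1:
  fixes lam :: real
  assumes "separable_space (euclidean :: 'a::metric_space topology)"
    and "1 < lam" and "lam \<le> 2"
    and "property_pi TYPE('a) lam"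
  shows "\<exists>f :: 'a \<Rightarrow> (nat \<Rightarrow>\<^sub>C real).
    range f \<subseteq> c0 \<and> strict_embedding lam f \<and> good_embedding lam f"
proof -
  obtain h :: "nat \<Rightarrow> 'a \<Rightarrow> real" where lip: "\<And>k. \<exists>L<lam. L-lipschitz_on UNIV (h k)"
    and null: "\<And>x. (\<lambda>k. h k x) \<longlonglongrightarrow> 0"
    and sep: "\<And>x y. x \<noteq> y \<Longrightarrow> \<exists>k. dist x y < \<bar>h k x - h k y\<bar>"
    using exists_null_separating_sequence[OF assms(1,2,4)] by blast
  define f where "f x = Bcontfun (\<lambda>k. h k x)" for x
  have f: "apply_bcontfun (f x) k = h k x" for x k
    unfolding f_def using Bcontfun_inverse[OF null_sequence_in_bcontfun[OF null]] by simp
  have "range f \<subseteq> c0" using null by (auto simp: c0_def f)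
  moreover have "strict_embedding lam f"
    unfolding strict_embedding_def
  proof (intro allI impI conjI)
    fix x y :: 'a assume "x \<noteq> y"
    have diff: "apply_bcontfun (f x - f y) k = h k x - h k y" for k by (simp add: f)
    obtain k where "dist x y < \<bar>h k x - h k y\<bar>" using sep[OF \<open>x \<noteq> y\<close>] by auto
    also have "\<dots> \<le> norm (f x - f y)" using norm_bounded[of "f x - f y" k] by (simp add: f)
    finally show "dist x y < norm (f x - f y)" .
    \<comment> \<open>The norm is a single coordinate difference, so the constant
      \<open>L < lam\<close> of that coordinate makes the bound strict although no common
      \<open>L\<close> is available.\<close>
    have "f x - f y \<in> c0" using tendsto_diff[OF null null, of x y] by (simp add: c0_def f)
    then obtain n where "norm (f x - f y) = \<bar>h n x - h n y\<bar>"
      using c0_norm_attained diff by metis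
    moreover obtain L where L: "L < lam" "L-lipschitz_on UNIV (h n)" using lip by auto
    moreover have "\<bar>h n x - h n y\<bar> \<le> L * dist x y"
      using lipschitz_onD[OF L(2), of x y] by (simp add: dist_real_def)
    moreover have "L * dist x y < lam * dist x y" using L \<open>x \<noteq> y\<close> by simp
    ultimately show "norm (f x - f y) < lam * dist x y" by simp
  qed
  moreover have "good_embedding lam f"
    unfolding good_embedding_def
  proof (intro conjI allI)
    show "Lip (\<lambda>x. apply_bcontfun (f x) n) < ereal lam" for n
      using lip[of n] by (auto simp: Lip_def f Inf_less_iff)
    show "\<exists>n. dist x y \<le> \<bar>apply_bcontfun (f x) n - apply_bcontfun (f y) n\<bar>" for x y
      using sep[of x y] by (cases "x = y") (auto simp: f intro: less_imp_le)
  qed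
  ultimately show ?thesis by blast
qed

end
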